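(* Let $$\lambda_1=\inf\left\{\frac{\sum_{n=1}^{T+1}|\Delta w(n-1)|^2}{\sum_{n=1}^T|w(n)|^2}\,:\, w\in X_{T+2},\ \|\Delta w\|_\infty<a,\ (w(0),w(T+1))\in D(\partial j),\ w|_{\mathbb{Z}[1,T]}\ne0\right\}.$$ If $\lambda_1>0$ then the following hold: (i) for any $w\in D(\Psi+J)$ one has $$|w(m)|\le a\left(\sqrt{\frac{T+1}{T\lambda_1}}+T\right)\qquad(m\in\mathbb{Z}[0,T+1]);$$ (ii) $\mathcal{E}=\Psi+J+\mathbf{F}$ is bounded from below and satisfies the (PS)-condition; (iii) $\mathcal{E}$ attains its infimum at some $u\in D(\Psi+J)$, which is a solution of the problem $$\begin{cases}-\Delta[\phi(\Delta u(n-1))]=\nabla_u F(n,u(n)) & (n\in\mathbb{Z}[1,T]),\\ (\phi(\Delta u(0)),-\phi(\Delta u(T)))\in\partial j(u(0),u(T+1)).\end{cases}$$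
   Context: $N\ge 1$ and $T\ge 2$ are fixed integers and $a>0$ is fixed. $\langle\cdot|\cdot\rangle$ and $|\cdot|$ are the Euclidean inner product and norm on $\mathbb{R}^N$, and $\mathbb{R}^N\times\mathbb{R}^N$ carries its usual inner product. $B_a=\{x\in\mathbb{R}^N:|x|<a\}$. $\mathbb{Z}[p,q]=\{p,\dots,q\}$. $X_{T+2}=\{u:\mathbb{Z}[0,T+1]\to\mathbb{R}^N\}$ with norm $\|u\|_{T+2}=(\sum_{n=0}^{T+1}|u(n)|^2)^{1/2}$. $\Delta u(n-1)=u(n)-u(n-1)$, $\Delta[\phi(\Delta u(n-1))]=\phi(\Delta u(n))-\phi(\Delta u(n-1))$, $\|\Delta u\|_\infty=\max_{n\in\mathbb{Z}[1,T+1]}|\Delta u(n-1)|$. Assumptions. (1) $\phi: B_a\to\mathbb{R}^N$ is a homeomorphism from $B_a$ onto $\mathbb{R}^N$ with $\phi(0)=0$ and $\phi=\nabla\Phi$ on $B_a$, where $\Phi:\overline{B}_a\to\mathbb{R}$ is of class $C^1$ on $B_a$, continuous and strictly convex on $\overline{B}_a$, $\Phi(0)=0$. (2) $F=F(n,u):\mathbb{Z}[1,T]\times\mathbb{R}^N\to\mathbb{R}$ is continuous, $\nabla_uF$ exists and is continuous on $\mathbb{Z}[1,T]\times\mathbb{R}^N$, and $F(\cdot,0)=0$. (3) $j:\mathbb{R}^N\times\mathbb{R}^N\to(-\infty,+\infty]$ is proper, convex, lower semicontinuous, $j(0,0)=0$ and $(0,0)\in\partial j(0,0)$, where $\partial j$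 is the subdifferential in the sense of convex analysis and $D(\partial j)=\{z:\partial j(z)\neq\emptyset\}$. Functionals on $X_{T+2}$: $\Psi(u)=\sum_{n=1}^{T+1}\Phi[\Delta u(n-1)]$ if $\|\Delta u\|_\infty\le a$ and $\Psi(u)=+\infty$ otherwise; $J(u)=j(u(0),u(T+1))$; $\mathbf{F}(u)=-\sum_{n=1}^TF(n,u(n))$, which is of class $C^1$ with $\langle\mathbf{F}'(u),v\rangle=-\sum_{n=1}^T\langle\nabla_uF(n,u(n))|v(n)\rangle$. $D(\cdot)$ applied to a functional denotes its effective domain, so $D(\Psi+J)=\{u\in X_{T+2}:\|\Delta u\|_\infty\le a,\ j(u(0),u(T+1))<+\infty\}$. A sequence $\{w_k\}\subset D(\Psi+J)$ is a (PS)-sequence for $\mathcal{E}$ if $\mathcal{E}(w_k)\to c\in\mathbb{R}$ and, for some $\varepsilon_k\to0$, $(\Psi+J)(v)-(\Psi+J)(w_k)+\langle\mathbf{F}'(w_k),v-w_k\rangle\ge-\varepsilon_k\|v-w_k\|_{T+2}$ for all $v\in D(\Psi+J)$. $\mathcal{E}$ satisfies the (PS)-condition if any (PS)-sequence has a subsequence convergent in $X_{T+2}$. A solution of the problem is a function $u\in X_{T+2}$ with $\|\Delta u\|_\infty<a$ and $(u(0),u(T+1))\in D(\partial j)$ that satisfies both the equations and the boundary condition. *)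

theory Defs
  imports "HOL-Analysis.Analysis"
begin

section \<open>Convex analysis\<close>

definition strictly_convex_on :: "'a::real_vector set \<Rightarrow> ('a \<Rightarrow> real) \<Rightarrow> bool" where
  "strictly_convex_on S f \<longleftrightarrow> convex S \<and>
     (\<forall>x\<in>S. \<forall>y\<in>S. \<forall>t. x \<noteq> y \<longrightarrow> 0 < t \<longrightarrow> t < 1 \<longrightarrow>
        f ((1 - t) *\<^sub>R x + t *\<^sub>R y) < (1 - t) * f x + t * f y)"

definition proper_fun :: "('a \<Rightarrow> ereal) \<Rightarrow> bool" where
  "proper_fun f \<longleftrightarrow> (\<forall>x. f x \<noteq> -\<infinity>) \<and> (\<exists>x. f x < \<infinity>)"

text \<open>The library's \<^const>\<open>convex_on\<close> is for real-valued functions. In the following inequality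
  \<^term>\<open>\<infinity> - \<infinity>\<close> does not occur for functions that omit \<^term>\<open>-\<infinity>\<close>.\<close>

definition convex_fun :: "('a::real_vector \<Rightarrow> ereal) \<Rightarrow> bool" where
  "convex_fun f \<longleftrightarrow>
     (\<forall>x y t. 0 < t \<longrightarrow> t < 1 \<longrightarrow>
        f ((1 - t) *\<^sub>R x + t *\<^sub>R y) \<le> ereal (1 - t) * f x + ereal t * f y)"

definition lsc_fun :: "('a::topological_space \<Rightarrow> ereal) \<Rightarrow> bool" where
  "lsc_fun f \<longleftrightarrow> (\<forall>x. f x \<le> Liminf (at x) f)"

text \<open>For a proper \<^term>\<open>f\<close> this set is empty at every point where \<^term>\<open>f\<close> is infinite.\<close>

definition subdifferential :: "('a::real_inner \<Rightarrow> ereal) \<Rightarrow> 'a \<Rightarrow> 'a set" where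
  "subdifferential f z = {\<zeta>. \<forall>y. f z + ereal (\<zeta> \<bullet> (y - z)) \<le> f y}"

definition subdiff_dom :: "('a::real_inner \<Rightarrow> ereal) \<Rightarrow> 'a set" where
  "subdiff_dom f = {z. subdifferential f z \<noteq> {}}"


section \<open>The sequence space and the forward difference\<close>

text \<open>Functions on \<open>{0, \<dots>, T + 1}\<close> are represented by the functions on the natural numbers with
  the fixed value \<^const>\<open>undefined\<close> outside that set. Differences of elements are only ever
  evaluated on \<open>{0, \<dots>, T + 1}\<close>.\<close>

definition seq_space :: "nat \<Rightarrow> (nat \<Rightarrow> real^'n) set" where
  "seq_space T = {0..T+1} \<rightarrow>\<^sub>E UNIV"

definition seq_norm :: "nat \<Rightarrow> (nat \<Rightarrow> real^'n) \<Rightarrow> real" where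
  "seq_norm T u = sqrt (\<Sum>n=0..T+1. (norm (u n))\<^sup>2)"

definition fdiff :: "(nat \<Rightarrow> 'a::ab_group_add) \<Rightarrow> nat \<Rightarrow> 'a" where
  "fdiff u n = u (n + 1) - u n"

definition fdiff_sup :: "nat \<Rightarrow> (nat \<Rightarrow> real^'n) \<Rightarrow> real" where
  "fdiff_sup T u = Max ((\<lambda>n. norm (fdiff u (n - 1))) ` {1..T+1})"


section \<open>The functionals\<close>

definition Psi :: "nat \<Rightarrow> real \<Rightarrow> (real^'n \<Rightarrow> real) \<Rightarrow> (nat \<Rightarrow> real^'n) \<Rightarrow> ereal" where
  "Psi T a \<Phi> u =
     (if fdiff_sup T u \<le> a then ereal (\<Sum>n=1..T+1. \<Phi> (fdiff u (n - 1))) else \<infinity>)"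

definition J_fun :: "nat \<Rightarrow> ((real^'n) \<times> (real^'n) \<Rightarrow> ereal) \<Rightarrow> (nat \<Rightarrow> real^'n) \<Rightarrow> ereal" where
  "J_fun T j u = j (u 0, u (T + 1))"

definition Psi_J ::
  "nat \<Rightarrow> real \<Rightarrow> (real^'n \<Rightarrow> real) \<Rightarrow> ((real^'n) \<times> (real^'n) \<Rightarrow> ereal)
     \<Rightarrow> (nat \<Rightarrow> real^'n) \<Rightarrow> ereal" where
  "Psi_J T a \<Phi> j u = Psi T a \<Phi> u + J_fun T j u"

definition F_fun :: "nat \<Rightarrow> (nat \<Rightarrow> real^'n \<Rightarrow> real) \<Rightarrow> (nat \<Rightarrow> real^'n) \<Rightarrow> real" where
  "F_fun T F u = - (\<Sum>n=1..T. F n (u n))"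

text \<open>\<open>F_deriv T gF u v\<close> is the derivative of \<open>F_fun T F\<close> at \<open>u\<close> in the direction \<open>v\<close>,
  where \<open>gF n\<close> is the gradient of \<open>F n\<close>; see \<open>F_fun_frechet\<close> below.\<close>

definition F_deriv ::
  "nat \<Rightarrow> (nat \<Rightarrow> real^'n \<Rightarrow> real^'n) \<Rightarrow> (nat \<Rightarrow> real^'n) \<Rightarrow> (nat \<Rightarrow> real^'n) \<Rightarrow> real" where
  "F_deriv T gF u v = - (\<Sum>n=1..T. gF n (u n) \<bullet> v n)"

definition energy ::
  "nat \<Rightarrow> real \<Rightarrow> (real^'n \<Rightarrow> real) \<Rightarrow> ((real^'n) \<times> (real^'n) \<Rightarrow> ereal)
     \<Rightarrow> (nat \<Rightarrow> real^'n \<Rightarrow> real) \<Rightarrow> (nat \<Rightarrow> real^'n) \<Rightarrow> ereal" where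
  "energy T a \<Phi> j F u = Psi_J T a \<Phi> j u + ereal (F_fun T F u)"

definition eff_dom :: "nat \<Rightarrow> ((nat \<Rightarrow> real^'n) \<Rightarrow> ereal) \<Rightarrow> (nat \<Rightarrow> real^'n) set" where
  "eff_dom T f = {u \<in> seq_space T. f u < \<infinity>}"

text \<open>If \<open>(0, 0)\<close> belongs to the domain of the subdifferential, the following set of quotients
  is nonempty; it is bounded below by 0, so the real infimum is the intended one.\<close>

definition lambda1 :: "nat \<Rightarrow> real \<Rightarrow> ((real^'n) \<times> (real^'n) \<Rightarrow> ereal) \<Rightarrow> real" where
  "lambda1 T a j =
     Inf {(\<Sum>n=1..T+1. (norm (fdiff w (n - 1)))\<^sup>2) / (\<Sum>n=1..T. (norm (w n))\<^sup>2) | w.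
            w \<in> seq_space T \<and> fdiff_sup T w < a \<and> (w 0, w (T + 1)) \<in> subdiff_dom j \<and>
            (\<exists>n\<in>{1..T}. w n \<noteq> 0)}"


section \<open>Palais-Smale condition and solutions\<close>

definition PS_sequence ::
  "nat \<Rightarrow> real \<Rightarrow> (real^'n \<Rightarrow> real) \<Rightarrow> ((real^'n) \<times> (real^'n) \<Rightarrow> ereal)
     \<Rightarrow> (nat \<Rightarrow> real^'n \<Rightarrow> real) \<Rightarrow> (nat \<Rightarrow> real^'n \<Rightarrow> real^'n)
     \<Rightarrow> (nat \<Rightarrow> nat \<Rightarrow> real^'n) \<Rightarrow> bool" where
  "PS_sequence T a \<Phi> j F gF w \<longleftrightarrow>
     (\<forall>k. w k \<in> eff_dom T (Psi_J T a \<Phi> j)) \<and>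
     (\<exists>c::real. (\<lambda>k. energy T a \<Phi> j F (w k)) \<longlonglongrightarrow> ereal c) \<and>
     (\<exists>\<epsilon>::nat \<Rightarrow> real. \<epsilon> \<longlonglongrightarrow> 0 \<and>
        (\<forall>k. \<forall>v \<in> eff_dom T (Psi_J T a \<Phi> j).
           Psi_J T a \<Phi> j v - Psi_J T a \<Phi> j (w k) + ereal (F_deriv T gF (w k) (\<lambda>n. v n - w k n))
             \<ge> ereal (- \<epsilon> k * seq_norm T (\<lambda>n. v n - w k n))))"

definition PS_condition ::
  "nat \<Rightarrow> real \<Rightarrow> (real^'n \<Rightarrow> real) \<Rightarrow> ((real^'n) \<times> (real^'n) \<Rightarrow> ereal)
     \<Rightarrow> (nat \<Rightarrow> real^'n \<Rightarrow> real) \<Rightarrow> (nat \<Rightarrow> real^'n \<Rightarrow> real^'n) \<Rightarrow> bool" where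
  "PS_condition T a \<Phi> j F gF \<longleftrightarrow>
     (\<forall>w. PS_sequence T a \<Phi> j F gF w \<longrightarrow>
        (\<exists>r. strict_mono r \<and>
           (\<exists>u \<in> seq_space T. (\<lambda>k. seq_norm T (\<lambda>n. w (r k) n - u n)) \<longlonglongrightarrow> 0)))"

definition is_solution ::
  "nat \<Rightarrow> real \<Rightarrow> (real^'n \<Rightarrow> real^'n) \<Rightarrow> ((real^'n) \<times> (real^'n) \<Rightarrow> ereal)
     \<Rightarrow> (nat \<Rightarrow> real^'n \<Rightarrow> real^'n) \<Rightarrow> (nat \<Rightarrow> real^'n) \<Rightarrow> bool" where
  "is_solution T a \<phi> j gF u \<longleftrightarrow>
     u \<in> seq_space T \<and> fdiff_sup T u < a \<and> (u 0, u (T + 1)) \<in> subdiff_dom j \<and>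
     (\<forall>n\<in>{1..T}. - fdiff (\<lambda>k. \<phi> (fdiff u k)) (n - 1) = gF n (u n)) \<and>
     (\<phi> (fdiff u 0), - \<phi> (fdiff u T)) \<in> subdifferential j (u 0, u (T + 1))"


section \<open>Checks of the definitions\<close>

lemma eff_dom_Psi_J:
  "eff_dom T (Psi_J T a \<Phi> j) =
     {u \<in> seq_space T. fdiff_sup T u \<le> a \<and> j (u 0, u (T + 1)) < \<infinity>}"
  by (auto simp: eff_dom_def Psi_J_def Psi_def J_fun_def)

lemma norm_le_seq_norm:
  assumes "n \<in> {0..T+1}"
  shows "norm (u n) \<le> seq_norm T u"
proof -
  have "(norm (u n))\<^sup>2 \<le> (\<Sum>n=0..T+1. (norm (u n))\<^sup>2)"
    using assms by (intro member_le_sum) auto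
  then show ?thesis
    unfolding seq_norm_def by (rule real_le_rsqrt)
qed

lemma F_fun_frechet:
  fixes F :: "nat \<Rightarrow> real^'n \<Rightarrow> real"
  assumes grad: "\<And>n. n \<in> {1..T} \<Longrightarrow> GDERIV (F n) (u n) :> gF n (u n)"
    and "e > 0"
  shows "\<exists>d>0. \<forall>v. seq_norm T (\<lambda>n. v n - u n) < d \<longrightarrow>
     \<bar>F_fun T F v - F_fun T F u - F_deriv T gF u (\<lambda>n. v n - u n)\<bar>
       \<le> e * seq_norm T (\<lambda>n. v n - u n)"
proof -
  define e' where "e' = e / (real T + 1)"
  have e': "e' > 0" using \<open>e > 0\<close> by (simp add: e'_def)
  have "\<exists>d>0. \<forall>y. norm (y - u n) < d \<longrightarrow>
          \<bar>F n y - F n (u n) - gF n (u n) \<bullet> (y - u n)\<bar> \<le> e' * norm (y - u n)"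
    if "n \<in> {1..T}" for n
    using grad[OF that] e' unfolding gderiv_def has_derivative_at_alt
    by (auto simp: inner_commute)
  then obtain d where d: "\<And>n. n \<in> {1..T} \<Longrightarrow> d n > 0"
    "\<And>n y. n \<in> {1..T} \<Longrightarrow> norm (y - u n) < d n \<Longrightarrow>
          \<bar>F n y - F n (u n) - gF n (u n) \<bullet> (y - u n)\<bar> \<le> e' * norm (y - u n)"
    by metis
  define D where "D = Min (insert 1 (d ` {1..T}))"
  have D: "D > 0" using d(1) unfolding D_def by (subst Min_gr_iff) auto
  have D_le: "D \<le> d n" if "n \<in> {1..T}" for n
    using that unfolding D_def by (intro Min_le) auto
  have "\<bar>F_fun T F v - F_fun T F u - F_deriv T gF u (\<lambda>n. v n - u n)\<bar>
       \<le> e * seq_norm T (\<lambda>n. v n - u n)"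
    if v: "seq_norm T (\<lambda>n. v n - u n) < D" for v
  proof -
    let ?s = "seq_norm T (\<lambda>n. v n - u n)"
    have s: "norm (v n - u n) \<le> ?s" if "n \<in> {1..T}" for n
      using norm_le_seq_norm[of n T "\<lambda>n. v n - u n"] that by auto
    have s0: "0 \<le> ?s" by (simp add: seq_norm_def sum_nonneg)
    have "F_fun T F v - F_fun T F u - F_deriv T gF u (\<lambda>n. v n - u n) =
        - (\<Sum>n=1..T. F n (v n) - F n (u n) - gF n (u n) \<bullet> (v n - u n))"
      by (simp add: F_fun_def F_deriv_def sum_subtractf)
    also have "\<bar>\<dots>\<bar> \<le> (\<Sum>n=1..T. \<bar>F n (v n) - F n (u n) - gF n (u n) \<bullet> (v n - u n)\<bar>)"
      by simp
    also have "\<dots> \<le> (\<Sum>n=1..T. e' * ?s)"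
    proof (rule sum_mono)
      fix n assume n: "n \<in> {1..T}"
      have "norm (v n - u n) < d n" using s[OF n] v D_le[OF n] by linarith
      from d(2)[OF n this] have "\<bar>F n (v n) - F n (u n) - gF n (u n) \<bullet> (v n - u n)\<bar>
          \<le> e' * norm (v n - u n)" .
      also have "\<dots> \<le> e' * ?s" using s[OF n] e' by simp
      finally show "\<bar>F n (v n) - F n (u n) - gF n (u n) \<bullet> (v n - u n)\<bar> \<le> e' * ?s" .
    qed
    also have "\<dots> = (real T * e') * ?s" by simp
    also have "\<dots> \<le> e * ?s"
      using s0 \<open>e > 0\<close> by (intro mult_right_mono) (auto simp: e'_def field_simps)
    finally show ?thesis .
  qed
  then show ?thesis using D by blast
qed

end

theory Submission
  imports Defs
begin

text \<open>
  The bound in the first assertion rests on \<open>lambda1\<close>, whose quotients only see sequences with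
  strictly bounded differences and endpoints in the domain of \<open>\<partial>j\<close>. It extends to the
  whole domain of \<open>\<Psi> + J\<close>: such a \<open>w\<close> is shrunk to \<open>t w\<close> with
  \<open>t < 1\<close>, which makes the differences strictly smaller than \<open>a\<close>, and then the endpoints
  are moved slightly into the domain of \<open>\<partial>j\<close>, which is dense in the domain of \<open>j\<close>
  (\<open>subdiff_dom_dense\<close>). Letting \<open>t \<rightarrow> 1\<close> bounds the sum of \<open>|w n|\<^sup>2\<close>
  over \<open>1 \<le> n \<le> T\<close>; hence one of the \<open>w n\<close> is small, and steps of length at most
  \<open>a\<close> control the others (\<open>norm_le_of_lambda1_pos\<close>).

  The domain of \<open>\<Psi> + J\<close> therefore lies in a compact set of sequences
  (\<open>compact_bounded_seqs\<close>). This gives the Palais-Smale condition at once, and a minimiser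
  \<open>u\<close> by lower semicontinuity (\<open>energy_attains_inf\<close>), so that the energy is bounded below.

  The minimiser solves the problem by comparison with explicit competitors. Suppose first that
  \<open>|\<Delta>u(m)| = a\<close> for some \<open>m\<close>. Since \<open>\<phi>\<close> is a homeomorphism onto the whole space,
  \<open>|\<phi>|\<close> tends to infinity at the boundary of the ball, and by convexity so does the radial
  derivative of \<open>\<Phi>\<close> (\<open>radial_derivative_blowup\<close>). Passing from \<open>u\<close> to
  \<open>(1 - t) u\<close> then decreases \<open>\<Phi>(\<Delta>u(m))\<close> by more than any prescribed multiple of
  \<open>t\<close>, whereas \<open>j\<close> does not increase and the other terms increase by at most a fixed
  multiple of \<open>t\<close>; this contradicts minimality (\<open>minimizer_fdiff_less\<close>). So all differences
  are strictly bounded by \<open>a\<close>, the smooth part of the energy is differentiable at \<open>u\<close>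
  along every line, and the first variation is available (\<open>minimizer_first_variation\<close>).
  Changing one interior value yields the difference equation; moving the endpoints towards an
  arbitrary point yields the inclusion in the subdifferential of \<open>j\<close>.
\<close>

section \<open>Lower semicontinuous convex functions\<close>

lemma lsc_fun_open_superlevel:
  assumes "lsc_fun f"
  shows "open {x. b < f x}"
proof (subst open_subopen, intro ballI)
  fix x assume "x \<in> {x. b < f x}"
  then have b: "b < f x" by simp
  with assms have "eventually (\<lambda>y. b < f y) (at x)"
    by (auto simp: lsc_fun_def le_Liminf_iff)
  then obtain S where "open S" "x \<in> S" "\<forall>y\<in>S. y \<noteq> x \<longrightarrow> b < f y"
    by (auto simp: eventually_at_topological)
  with b show "\<exists>S. open S \<and> x \<in> S \<and> S \<subseteq> {x. b < f x}" by auto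
qed

text \<open>An extended Weierstrass theorem. If the infimum were not attained, the strict superlevel sets
  \<open>U y\<close> at the values would form an open cover of \<open>K\<close>, and a point of minimal value among
  finitely many cannot be covered by the corresponding sets.\<close>
lemma lsc_plus_continuous_attains_inf:
  fixes f :: "'b::topological_space \<Rightarrow> ereal" and p :: "'a::topological_space \<Rightarrow> 'b"
    and g :: "'a \<Rightarrow> real"
  assumes f: "lsc_fun f" and K: "compact K" "K \<noteq> {}"
    and p: "continuous_on K p" and g: "continuous_on K g"
  shows "\<exists>x\<in>K. \<forall>y\<in>K. f (p x) + ereal (g x) \<le> f (p y) + ereal (g y)"
proof (rule ccontr)
  define e where "e = (\<lambda>x. f (p x) + ereal (g x))"
  assume "\<not> ?thesis"
  then have nomin: "\<exists>y\<in>K. e y < e x" if "x \<in> K" for x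
    using that by (auto simp: e_def not_le)
  define U where "U y = {x \<in> K. e y < e x}" for y
  have openU: "openin (top_of_set K) (U y)" for y
  proof (subst openin_subopen, intro ballI)
    fix x assume "x \<in> U y"
    then have x: "x \<in> K" "e y < f (p x) + ereal (g x)" by (auto simp: U_def e_def)
    then have "e y - ereal (g x) < f (p x)"
      by (simp add: ereal_minus_less)
    then obtain c where c: "e y - ereal (g x) < ereal c" "ereal c < f (p x)"
      using ereal_dense2 by blast
    define V where "V = (K \<inter> p -` {z. ereal c < f z}) \<inter> {x'\<in>K. e y - ereal (g x') < ereal c}"
    have "openin (top_of_set K) (K \<inter> p -` {z. ereal c < f z})"
      using continuous_openin_preimage_gen[OF p lsc_fun_open_superlevel[OF f]] .
    moreover have "openin (top_of_set K) {x'\<in>K. e y - ereal (g x') < ereal c}"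
    proof (cases "e y")
      case (real r)
      have "openin (top_of_set K) (K \<inter> g -` {r - c<..})"
        by (rule continuous_openin_preimage_gen[OF g]) auto
      moreover have "K \<inter> g -` {r - c<..} = {x'\<in>K. e y - ereal (g x') < ereal c}"
        using real by auto
      ultimately show ?thesis by simp
    next
      case PInf
      then show ?thesis using c by simp
    next
      case MInf
      then show ?thesis by simp
    qed
    ultimately have "openin (top_of_set K) V" unfolding V_def by (rule openin_Int)
    moreover have "x \<in> V" using x c by (auto simp: V_def)
    moreover have "V \<subseteq> U y"
    proof
      fix x' assume "x' \<in> V"
      then have "x' \<in> K" "e y - ereal (g x') < f (p x')" by (auto simp: V_def)
      then show "x' \<in> U y" by (simp add: U_def e_def ereal_minus_less)
    qed
    ultimately show "\<exists>V. openin (top_of_set K) V \<and> x \<in> V \<and> V \<subseteq> U y" by blast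
  qed
  have cov: "K \<subseteq> \<Union>(U ` K)" using nomin by (auto simp: U_def)
  have "\<exists>D\<subseteq>U ` K. finite D \<and> K \<subseteq> \<Union>D"
    using K(1)[unfolded compact_eq_openin_cover, THEN spec, THEN mp, of "U ` K"] cov openU by simp
  then obtain D where D: "D \<subseteq> K" "finite D" "K \<subseteq> \<Union>(U ` D)"
    using finite_subset_image[of _ U K] by metis
  then have "D \<noteq> {}" using K(2) by auto
  then obtain y where y: "y \<in> D" "\<And>z. z \<in> D \<Longrightarrow> e y \<le> e z"
    using D(2) ex_min_if_finite[of "e ` D"] by (auto simp: not_less)
  then obtain z where "z \<in> D" "e z < e y" using D by (auto simp: U_def)
  then show False using y by (simp add: leD)
qed

text \<open>A form of the Broendsted-Rockafellar density theorem. The approximating point is the minimiser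
  \<open>y\<close> of the Moreau regularisation \<open>f x + |x - z|\<^sup>2 / (2 e)\<close>; the vector
  \<open>(z - y) / e\<close> is a subgradient at \<open>y\<close>.\<close>
lemma subdiff_dom_dense:
  fixes f :: "'a::euclidean_space \<Rightarrow> ereal"
  assumes conv: "convex_fun f" and lsc: "lsc_fun f" and nonneg: "\<And>x. 0 \<le> f x"
    and z: "f z < \<infinity>" and d: "0 < d"
  shows "\<exists>y\<in>subdiff_dom f. dist y z < d"
proof -
  obtain b where b: "f z = ereal b" "0 \<le> b" using z nonneg[of z] by (cases "f z") auto
  \<comment> \<open>With this \<open>e\<close> the penalty exceeds \<open>f z\<close> at distance \<open>d\<close> from \<open>z\<close>, so that
    minimising over the ball is minimising over the whole space.\<close>
  define e where "e = d\<^sup>2 / (2 * (b + 1))"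
  have e: "0 < e" "(b + 1) * (2 * e) = d\<^sup>2" using d b by (simp_all add: e_def field_simps)
  define q where "q y = (norm (y - z))\<^sup>2 / (2 * e)" for y
  have "\<exists>x\<in>cball z d. \<forall>y\<in>cball z d. f (id x) + ereal (q x) \<le> f (id y) + ereal (q y)"
  proof (rule lsc_plus_continuous_attains_inf[OF lsc])
    show "continuous_on (cball z d) q"
      unfolding q_def using e by (intro continuous_intros) auto
  qed (use d in auto)
  then obtain y where y: "dist z y \<le> d"
    "\<And>x. dist z x \<le> d \<Longrightarrow> f y + ereal (q y) \<le> f x + ereal (q x)"
    by auto
  have yz: "f y + ereal (q y) \<le> ereal b"
    using y(2)[of z] d b by (simp add: q_def)
  have min: "f y + ereal (q y) \<le> f x + ereal (q x)" for x
  proof (cases "dist z x \<le> d")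
    case False
    then have "d\<^sup>2 \<le> (norm (x - z))\<^sup>2"
      using d by (intro power_mono) (auto simp: dist_norm norm_minus_commute)
    then have "b + 1 \<le> q x" using e by (simp add: q_def pos_le_divide_eq)
    then have "0 + ereal b \<le> f x + ereal (q x)"
      using nonneg[of x] by (intro add_mono) auto
    then have "ereal b \<le> f x + ereal (q x)" by simp
    with yz show ?thesis by (rule order_trans)
  qed (use y in auto)
  obtain c where c: "f y = ereal c" using yz nonneg[of y] by (cases "f y") auto
  have "0 \<le> c" using nonneg[of y] c by simp
  then have "q y < b + 1" using yz c by simp
  then have "(norm (y - z))\<^sup>2 < d\<^sup>2" using e by (simp add: q_def pos_divide_less_eq)
  then have dist: "dist y z < d" using d by (simp add: dist_norm power2_less_imp_less)
  have "f y + ereal ((1 / e) *\<^sub>R (z - y) \<bullet> (x - y)) \<le> f x" for x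
  proof (cases "f x")
    case (real r)
    \<comment> \<open>Comparing \<open>y\<close> with a point on the segment to \<open>x\<close> leaves an error of order \<open>t\<close>.\<close>
    have ineq: "c + (1 / e) *\<^sub>R (z - y) \<bullet> (x - y) \<le> r + t * ((norm (x - y))\<^sup>2 / (2 * e))"
      if t: "0 < t" "t < 1" for t
    proof -
      let ?x = "(1 - t) *\<^sub>R y + t *\<^sub>R x"
      have "f ?x \<le> ereal (1 - t) * f y + ereal t * f x"
        using conv t by (auto simp: convex_fun_def)
      then have "f ?x \<le> ereal ((1 - t) * c + t * r)" using c real by simp
      then have "ereal (c + q y) \<le> ereal ((1 - t) * c + t * r + q ?x)"
        using min[of ?x] c by (cases "f ?x") auto
      moreover have "q ?x = q y - t * ((1 / e) *\<^sub>R (z - y) \<bullet> (x - y))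
          + t * (t * ((norm (x - y))\<^sup>2 / (2 * e)))"
      proof -
        have "?x - z = t *\<^sub>R (x - y) - (z - y)" by (simp add: algebra_simps)
        moreover have "(norm (t *\<^sub>R u - v))\<^sup>2
            = (norm v)\<^sup>2 - 2 * t * (v \<bullet> u) + t * (t * (norm u)\<^sup>2)" for u v :: 'a
          by (simp add: power2_norm_eq_inner inner_diff_left inner_diff_right inner_commute algebra_simps)
        ultimately have "(norm (?x - z))\<^sup>2 = (norm (z - y))\<^sup>2 - 2 * t * ((z - y) \<bullet> (x - y))
            + t * (t * (norm (x - y))\<^sup>2)"
          by (simp only:)
        then show ?thesis using e(1)
          unfolding q_def inner_scaleR_left norm_minus_commute[of y z]
          by (simp only:) (simp add: add_divide_distrib diff_divide_distrib)
      qed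
      ultimately have "t * (c + (1 / e) *\<^sub>R (z - y) \<bullet> (x - y))
          \<le> t * (r + t * ((norm (x - y))\<^sup>2 / (2 * e)))"
        by (simp only: ereal_less_eq distrib_left left_diff_distrib)
      then show ?thesis using t by (simp only: mult_le_cancel_left_pos)
    qed
    have "((\<lambda>t. r + t * ((norm (x - y))\<^sup>2 / (2 * e))) \<longlongrightarrow> r + 0 * ((norm (x - y))\<^sup>2 / (2 * e))) (at_right 0)"
      by (intro tendsto_intros)
    moreover have "eventually (\<lambda>t. c + (1 / e) *\<^sub>R (z - y) \<bullet> (x - y)
        \<le> r + t * ((norm (x - y))\<^sup>2 / (2 * e))) (at_right 0)"
      using ineq unfolding eventually_at_right_field by (intro exI[of _ 1]) simp
    ultimately have "c + (1 / e) *\<^sub>R (z - y) \<bullet> (x - y) \<le> r"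
      using tendsto_lowerbound by fastforce
    then show ?thesis using c real by simp
  qed (use nonneg[of x] c in auto)
  then have "(1 / e) *\<^sub>R (z - y) \<in> subdifferential f y"
    by (simp add: subdifferential_def)
  then have "y \<in> subdiff_dom f" by (auto simp: subdiff_dom_def)
  with dist show ?thesis by blast
qed

section \<open>Bounds from the Rayleigh quotient\<close>

lemma image_pred_atLeast1: "(\<lambda>n. h (n - 1)) ` {1..T+1} = h ` {..T}" for T :: nat
proof -
  have "{1..T+1} = Suc ` {..T}" by (simp add: image_Suc_atMost)
  then show ?thesis by (simp add: image_image)
qed

lemma fdiff_sup_le_iff: "fdiff_sup T u \<le> c \<longleftrightarrow> (\<forall>n\<le>T. norm (fdiff u n) \<le> c)"
proof -
  have "(\<lambda>n. norm (fdiff u (n - 1))) ` {1..T+1} = (\<lambda>n. norm (fdiff u n)) ` {..T}"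
    by (rule image_pred_atLeast1)
  then show ?thesis unfolding fdiff_sup_def by (subst Max_le_iff) auto
qed

lemma fdiff_sup_less_iff: "fdiff_sup T u < c \<longleftrightarrow> (\<forall>n\<le>T. norm (fdiff u n) < c)"
proof -
  have "(\<lambda>n. norm (fdiff u (n - 1))) ` {1..T+1} = (\<lambda>n. norm (fdiff u n)) ` {..T}"
    by (rule image_pred_atLeast1)
  then show ?thesis unfolding fdiff_sup_def by (subst Max_less_iff) auto
qed

lemma sum_shift_pred: "(\<Sum>n=1..T+1. h (n - 1)) = (\<Sum>n\<le>T. h n)" for T :: nat
  by (rule sum.reindex_bij_witness[of _ Suc "\<lambda>n. n - 1"]) auto

lemma lambda1_mult_le:
  assumes w: "w \<in> seq_space T" "fdiff_sup T w < a" "(w 0, w (T + 1)) \<in> subdiff_dom j"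
  shows "lambda1 T a j * (\<Sum>n=1..T. (norm (w n))\<^sup>2) \<le> (\<Sum>n\<le>T. (norm (fdiff w n))\<^sup>2)"
proof (cases "\<exists>n\<in>{1..T}. w n \<noteq> 0")
  case True
  then have pos: "0 < (\<Sum>n=1..T. (norm (w n))\<^sup>2)"
    by (auto intro!: sum_pos2)
  have "lambda1 T a j \<le> (\<Sum>n=1..T+1. (norm (fdiff w (n - 1)))\<^sup>2) / (\<Sum>n=1..T. (norm (w n))\<^sup>2)"
    unfolding lambda1_def
  proof (rule cInf_lower)
    show "bdd_below {(\<Sum>n=1..T+1. (norm (fdiff w (n - 1)))\<^sup>2) / (\<Sum>n=1..T. (norm (w n))\<^sup>2) | w.
            w \<in> seq_space T \<and> fdiff_sup T w < a \<and> (w 0, w (T + 1)) \<in> subdiff_dom j \<and>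
            (\<exists>n\<in>{1..T}. w n \<noteq> 0)}"
      by (rule bdd_belowI[of _ 0]) (auto intro!: divide_nonneg_nonneg sum_nonneg simp del: sum.cl_ivl_Suc)
  qed (use w True in blast)
  then show ?thesis using pos
    by (simp only: sum_shift_pred[of "\<lambda>n. (norm (fdiff w n))\<^sup>2"] pos_le_divide_eq)
next
  case False
  then show ?thesis by (simp add: sum_nonneg)
qed

text \<open>The defining inequality of \<open>lambda1\<close> is extended to the domain of \<open>\<Psi> + J\<close>, with the sum
  of the squared differences replaced by its largest possible value.\<close>
lemma lambda1_mult_le_on_dom:
  fixes w :: "nat \<Rightarrow> real^'n"
  assumes a: "0 < a"
    and conv: "convex_fun j" and lsc: "lsc_fun j" and nonneg: "\<And>z. 0 \<le> j z" and j0: "j 0 = 0"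
    and w: "fdiff_sup T w \<le> a" "j (w 0, w (T + 1)) < \<infinity>"
  shows "lambda1 T a j * (\<Sum>n=1..T. (norm (w n))\<^sup>2) \<le> (real T + 1) * a\<^sup>2"
proof (rule field_le_mult_one_interval)
  fix s :: real assume s: "0 < s" "s < 1"
  define t where "t = sqrt s"
  have t: "0 < t" "t < 1" "t\<^sup>2 = s" using s by (simp_all add: t_def)
  let ?z = "(w 0, w (T + 1))"
  have "j ((1 - t) *\<^sub>R 0 + t *\<^sub>R ?z) \<le> ereal (1 - t) * j 0 + ereal t * j ?z"
    using conv t unfolding convex_fun_def by blast
  also have "\<dots> < \<infinity>" using w(2) nonneg[of ?z] t j0 by (cases "j ?z") auto
  finally have "j (t *\<^sub>R ?z) < \<infinity>" by simp
  \<comment> \<open>Two endpoint errors smaller than \<open>d\<close> together fill the gap between \<open>t a\<close> and \<open>a\<close>.\<close>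
  moreover define d where "d = (1 - t) * a / 2"
  moreover have "0 < d" using t a by (simp add: d_def)
  ultimately obtain y where y: "y \<in> subdiff_dom j" "dist y (t *\<^sub>R ?z) < d"
    using subdiff_dom_dense[OF conv lsc nonneg] by blast
  \<comment> \<open>An admissible competitor: \<open>t w\<close> with its endpoints replaced by those of \<open>y\<close>.\<close>
  define v where "v = restrict (\<lambda>n. if n = 0 then fst y else if n = T + 1 then snd y else t *\<^sub>R w n) {0..T+1}"
  have close: "norm (v n - t *\<^sub>R w n) < d" if "n \<le> T + 1" for n
  proof -
    have "norm (fst y - t *\<^sub>R w 0) < d" "norm (snd y - t *\<^sub>R w (T + 1)) < d"
      using y(2) dist_fst_le[of y "t *\<^sub>R ?z"] dist_snd_le[of y "t *\<^sub>R ?z"] by (auto simp: dist_norm)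
    with \<open>0 < d\<close> that show ?thesis by (auto simp: v_def)
  qed
  have small: "norm (fdiff v n) < a" if n: "n \<le> T" for n
  proof -
    have "fdiff v n = t *\<^sub>R fdiff w n + (v (n + 1) - t *\<^sub>R w (n + 1)) - (v n - t *\<^sub>R w n)"
      by (simp add: fdiff_def algebra_simps)
    also have "norm \<dots> \<le> norm (t *\<^sub>R fdiff w n) + norm (v (n + 1) - t *\<^sub>R w (n + 1))
        + norm (v n - t *\<^sub>R w n)"
      by (meson add_right_mono norm_triangle_ineq norm_triangle_ineq4 order_trans)
    also have "\<dots> < t * a + d + d"
    proof -
      have "norm (t *\<^sub>R fdiff w n) \<le> t * a" using t w(1) n by (simp add: fdiff_sup_le_iff)
      then show ?thesis using close[of n] close[of "n + 1"] n by simp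
    qed
    also have "\<dots> = a" by (simp add: d_def field_simps)
    finally show ?thesis .
  qed
  have "s * (lambda1 T a j * (\<Sum>n=1..T. (norm (w n))\<^sup>2)) = lambda1 T a j * (\<Sum>n=1..T. (norm (v n))\<^sup>2)"
  proof -
    have "(\<Sum>n=1..T. (norm (v n))\<^sup>2) = (\<Sum>n=1..T. s * (norm (w n))\<^sup>2)"
      by (intro sum.cong) (auto simp: v_def power_mult_distrib t)
    then show ?thesis by (simp add: sum_distrib_left mult.left_commute)
  qed
  also have "\<dots> \<le> (\<Sum>n\<le>T. (norm (fdiff v n))\<^sup>2)"
  proof (rule lambda1_mult_le)
    show "v \<in> seq_space T" by (simp add: v_def seq_space_def)
    show "fdiff_sup T v < a" using small by (simp add: fdiff_sup_less_iff)
    show "(v 0, v (T + 1)) \<in> subdiff_dom j" using y(1) by (simp add: v_def)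
  qed
  also have "\<dots> \<le> (\<Sum>n\<le>T. a\<^sup>2)"
    using small by (intro sum_mono power_mono) (auto simp: less_imp_le)
  also have "\<dots> = (real T + 1) * a\<^sup>2" by simp
  finally show "s * (lambda1 T a j * (\<Sum>n=1..T. (norm (w n))\<^sup>2)) \<le> (real T + 1) * a\<^sup>2" .
qed

lemma norm_diff_le_steps:
  fixes w :: "nat \<Rightarrow> 'a::real_normed_vector"
  assumes "\<And>n. n \<le> T \<Longrightarrow> norm (fdiff w n) \<le> a" and "m \<le> k" "k \<le> T + 1"
  shows "norm (w k - w m) \<le> real (k - m) * a"
  using assms(2,3)
proof (induction k rule: dec_induct)
  case (step k)
  have "norm (w (Suc k) - w m) \<le> norm (fdiff w k) + norm (w k - w m)"
    using norm_triangle_ineq[of "fdiff w k" "w k - w m"] by (simp add: fdiff_def)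
  also have "\<dots> \<le> a + real (k - m) * a"
    using step assms(1)[of k] by (intro add_mono) auto
  finally show ?case using step by (simp add: Suc_diff_le algebra_simps)
qed simp

lemma norm_le_of_lambda1_pos:
  fixes w :: "nat \<Rightarrow> real^'n"
  assumes a: "0 < a" and T: "1 \<le> T"
    and conv: "convex_fun j" and lsc: "lsc_fun j" and nonneg: "\<And>z. 0 \<le> j z" and j0: "j 0 = 0"
    and lambda: "0 < lambda1 T a j"
    and w: "fdiff_sup T w \<le> a" "j (w 0, w (T + 1)) < \<infinity>" and m: "m \<le> T + 1"
  shows "norm (w m) \<le> a * (sqrt ((real T + 1) / (real T * lambda1 T a j)) + real T)"
proof -
  let ?b = "a * sqrt ((real T + 1) / (real T * lambda1 T a j))"
  have b2: "?b\<^sup>2 = a\<^sup>2 * (real T + 1) / (real T * lambda1 T a j)"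
    using lambda by (simp add: power_mult_distrib)
  have "\<exists>k\<in>{1..T}. norm (w k) \<le> ?b"
  proof (rule ccontr)
    assume "\<not> ?thesis"
    then have *: "?b < norm (w k)" if "k \<in> {1..T}" for k using that by (auto simp: not_le)
    have "(\<Sum>k=1..T. ?b\<^sup>2) < (\<Sum>k=1..T. (norm (w k))\<^sup>2)"
      using * T a lambda by (intro sum_strict_mono power_strict_mono) auto
    then have "lambda1 T a j * (real T * ?b\<^sup>2) < lambda1 T a j * (\<Sum>k=1..T. (norm (w k))\<^sup>2)"
      using lambda by simp
    also have "\<dots> \<le> (real T + 1) * a\<^sup>2"
      by (rule lambda1_mult_le_on_dom[OF a conv lsc nonneg j0 w])
    also have "lambda1 T a j * (real T * ?b\<^sup>2) = (real T + 1) * a\<^sup>2"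
      unfolding b2 using lambda T by (simp add: field_simps)
    finally show False by simp
  qed
  then obtain k where k: "1 \<le> k" "k \<le> T" "norm (w k) \<le> ?b" by auto
  have step: "norm (fdiff w n) \<le> a" if "n \<le> T" for n
    using w(1) that by (simp add: fdiff_sup_le_iff)
  have "norm (w m - w k) \<le> real T * a"
  proof (cases "m \<le> k")
    case True
    then have "norm (w k - w m) \<le> real (k - m) * a"
      using norm_diff_le_steps[OF step] k by simp
    also have "\<dots> \<le> real T * a" using a k by (intro mult_right_mono) auto
    finally show ?thesis by (simp add: norm_minus_commute)
  next
    case False
    then have "norm (w m - w k) \<le> real (m - k) * a"
      using norm_diff_le_steps[OF step] m by simp
    also have "\<dots> \<le> real T * a" using a k m by (intro mult_right_mono) auto
    finally show ?thesis .
  qed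
  then have "norm (w m) \<le> ?b + real T * a"
    using k(3) norm_triangle_sub[of "w m" "w k"] by linarith
  then show ?thesis by (simp add: algebra_simps)
qed

text \<open>Compactness refers to the product topology of \<open>nat \<Rightarrow> real^'n\<close>; outside \<open>{0..T+1}\<close> the
  sequences take the fixed value \<open>undefined\<close>, so the set is a closed subset of a product of compact sets.\<close>
lemma compact_bounded_seqs:
  "compact {w \<in> seq_space T. (\<forall>n\<le>T+1. norm (w n :: real^'n) \<le> R) \<and> (\<forall>n\<le>T. norm (fdiff w n) \<le> a)}"
proof -
  define S :: "nat \<Rightarrow> (real^'n) set" where "S n = (if n \<le> T + 1 then cball 0 R else {undefined})" for n
  have "compactin (product_topology (\<lambda>i. euclidean) UNIV) (PiE UNIV S)"
    unfolding compactin_PiE by (auto simp: S_def)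
  then have "compact (PiE UNIV S)"
    by (simp only: euclidean_product_topology compactin_euclidean_iff)
  moreover have "closed {w :: nat \<Rightarrow> real^'n. \<forall>n\<le>T. norm (fdiff w n) \<le> a}"
    unfolding fdiff_def by (intro closed_Collect_all closed_Collect_imp closed_Collect_le continuous_intros) auto
  ultimately have "compact (PiE UNIV S \<inter> {w. \<forall>n\<le>T. norm (fdiff w n) \<le> a})"
    by (rule compact_Int_closed)
  moreover have "PiE UNIV S \<inter> {w. \<forall>n\<le>T. norm (fdiff w n) \<le> a}
     = {w \<in> seq_space T. (\<forall>n\<le>T+1. norm (w n) \<le> R) \<and> (\<forall>n\<le>T. norm (fdiff w n) \<le> a)}"
    by (auto simp: S_def seq_space_def PiE_iff extensional_def split: if_splits)
  ultimately show ?thesis by simp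
qed

section \<open>Gradients of convex potentials\<close>

lemma GDERIV_along_line:
  assumes "GDERIV f x :> g"
  shows "((\<lambda>t. f (x + t *\<^sub>R h)) has_real_derivative (g \<bullet> h)) (at 0)"
proof -
  have "((\<lambda>t. x + t *\<^sub>R h) has_derivative (\<lambda>t. t *\<^sub>R h)) (at (0::real))"
    by (auto intro!: derivative_eq_intros)
  moreover have "(f has_derivative (\<lambda>k. k \<bullet> g)) (at (x + 0 *\<^sub>R h))"
    using assms by (simp add: gderiv_def)
  ultimately have "((\<lambda>t. f (x + t *\<^sub>R h)) has_derivative (\<lambda>t. (t *\<^sub>R h) \<bullet> g)) (at 0)"
    by (rule has_derivative_compose)
  then show ?thesis
    by (rule has_derivative_imp_has_field_derivative) (simp add: inner_commute)
qed

lemma gradient_inequality: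
  fixes f :: "'a::real_inner \<Rightarrow> real"
  assumes conv: "convex_on S f" and x: "x \<in> S" "y \<in> S" and grad: "GDERIV f x :> g"
  shows "f x + g \<bullet> (y - x) \<le> f y"
proof (rule ccontr)
  assume neg: "\<not> ?thesis"
  define h where "h t = f (x + t *\<^sub>R (y - x)) - t * (f y - f x)" for t
  have "(h has_real_derivative (g \<bullet> (y - x) - (f y - f x))) (at 0)"
    unfolding h_def by (auto intro!: derivative_eq_intros GDERIV_along_line[OF grad])
  then obtain d where d: "d > 0" "\<And>t. t > 0 \<Longrightarrow> t < d \<Longrightarrow> h 0 < h t"
    using has_real_derivative_pos_inc_right[of h _ 0 UNIV] neg by force
  define t where "t = min (d / 2) (1/2)"
  have t: "0 < t" "t < d" "t < 1" using d(1) by (auto simp: t_def)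
  have "f ((1 - t) *\<^sub>R x + t *\<^sub>R y) \<le> (1 - t) * f x + t * f y"
    using conv x t by (auto simp: convex_on_def)
  moreover have "(1 - t) *\<^sub>R x + t *\<^sub>R y = x + t *\<^sub>R (y - x)" by (simp add: algebra_simps)
  ultimately have "h t \<le> h 0" by (simp add: h_def algebra_simps)
  with d(2)[OF t(1,2)] show False by simp
qed

text \<open>The preimage of a closed ball is compact in the open ball of radius \<open>a\<close>, hence stays away
  from its boundary.\<close>
lemma homeomorphism_ball_norm_blowup:
  fixes f :: "'a::euclidean_space \<Rightarrow> 'b::euclidean_space"
  assumes hom: "homeomorphism (ball 0 a) UNIV f g" and "0 \<le> C"
  obtains r where "r < a" "\<And>x. r < norm x \<Longrightarrow> norm x < a \<Longrightarrow> C < norm (f x)"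
proof -
  have sub: "g ` cball 0 C \<subseteq> ball 0 a" using hom by (auto simp: homeomorphism_def)
  have "continuous_on (cball 0 C) (\<lambda>y. norm (g y))"
    using hom by (intro continuous_intros) (auto simp: homeomorphism_def intro: continuous_on_subset)
  then obtain y where y: "y \<in> cball 0 C" "\<And>z. z \<in> cball 0 C \<Longrightarrow> norm (g z) \<le> norm (g y)"
    using continuous_attains_sup[of "cball 0 C" "\<lambda>y. norm (g y)"] \<open>0 \<le> C\<close> by auto
  show thesis
  proof
    show "norm (g y) < a" using sub y(1) by force
    fix x :: 'a assume x: "norm (g y) < norm x" "norm x < a"
    then have "g (f x) = x" using hom by (simp add: homeomorphism_def)
    then show "C < norm (f x)" using y(2)[of "f x"] x by force
  qed
qed

text \<open>At a boundary point \<open>x\<close> the inward radial slope of \<open>\<Phi>\<close> is \<open>-\<infinity>\<close>: the gradient inequality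
  at \<open>y = (1 - t) x\<close>, tested with the vector of length \<open>a / 2\<close> in the direction of
  \<open>\<phi> y\<close>, shows that \<open>\<phi> y \<bullet> y\<close> is at least \<open>a / 2 * |\<phi> y|\<close> up to a constant.\<close>
lemma radial_derivative_blowup:
  fixes \<Phi> :: "'a::euclidean_space \<Rightarrow> real"
  assumes a: "0 < a" and hom: "homeomorphism (ball 0 a) UNIV \<phi> \<psi>"
    and grad: "\<And>x. x \<in> ball 0 a \<Longrightarrow> GDERIV \<Phi> x :> \<phi> x"
    and cont: "continuous_on (cball 0 a) \<Phi>" and conv: "convex_on (cball 0 a) \<Phi>"
    and x: "norm x = a"
  obtains d where "0 < d" "\<And>t. 0 < t \<Longrightarrow> t < d \<Longrightarrow> \<Phi> ((1 - t) *\<^sub>R x) \<le> \<Phi> x - t * C"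
proof -
  obtain M where M: "\<And>y. y \<in> cball 0 a \<Longrightarrow> \<bar>\<Phi> y\<bar> \<le> M"
    using compact_imp_bounded[OF compact_continuous_image[OF cont compact_cball]]
    unfolding bounded_iff by force
  have "0 \<le> M" using M[of 0] a by force
  \<comment> \<open>\<open>K\<close> is the value of \<open>|\<phi> y|\<close> for which \<open>a / 2 * |\<phi> y| - 2 M\<close> equals \<open>|C|\<close>.\<close>
  define K where "K = (2 * M + \<bar>C\<bar>) / (a / 2)"
  have "0 \<le> K" using a \<open>0 \<le> M\<close> by (simp add: K_def)
  with hom obtain r where r: "r < a" "\<And>y. r < norm y \<Longrightarrow> norm y < a \<Longrightarrow> K < norm (\<phi> y)"
    using homeomorphism_ball_norm_blowup[of a \<phi> \<psi> K] by metis
  show thesis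
  proof
    show "0 < min 1 (1 - r / a)" using r a by simp
    fix t assume t: "0 < t" "t < min 1 (1 - r / a)"
    let ?y = "(1 - t) *\<^sub>R x"
    have ny: "norm ?y = (1 - t) * a" using t x by simp
    then have y: "r < norm ?y" "norm ?y < a"
      unfolding ny using t a by (simp_all add: field_simps)
    have "0 < 1 - t" using t by simp
    have grad_y: "\<Phi> ?y + \<phi> ?y \<bullet> (z - ?y) \<le> \<Phi> z" if "z \<in> cball 0 a" for z
      using that y by (intro gradient_inequality[OF conv] grad) auto
    define z where "z = (a / 2 / norm (\<phi> ?y)) *\<^sub>R \<phi> ?y"
    have K: "K < norm (\<phi> ?y)" using r y by simp
    then have "\<phi> ?y \<noteq> 0" using \<open>0 \<le> K\<close> by (metis norm_zero not_le)
    then have "norm z = a / 2" using a by (simp add: z_def)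
    moreover have "\<phi> ?y \<bullet> z = a / 2 * norm (\<phi> ?y)"
      using \<open>\<phi> ?y \<noteq> 0\<close> by (simp add: z_def power2_norm_eq_inner[symmetric] power2_eq_square)
    moreover have "2 * M + \<bar>C\<bar> \<le> a / 2 * norm (\<phi> ?y)"
      using K a by (simp add: K_def field_simps)
    ultimately have C: "\<bar>C\<bar> \<le> \<phi> ?y \<bullet> ?y"
      using grad_y[of z] M[of z] M[of ?y] y a by (simp add: inner_diff_right)
    also have "\<phi> ?y \<bullet> ?y = (1 - t) * (\<phi> ?y \<bullet> x)" by simp
    finally have "0 \<le> (1 - t) * (\<phi> ?y \<bullet> x)" by (rule order_trans[OF abs_ge_zero])
    then have "0 \<le> t * (\<phi> ?y \<bullet> x)"
      using t \<open>0 < 1 - t\<close> by (simp add: zero_le_mult_iff)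
    then have "C \<le> \<phi> ?y \<bullet> x" using C by (simp add: left_diff_distrib)
    then have "t * C \<le> t * (\<phi> ?y \<bullet> x)" using t by simp
    moreover have "\<Phi> ?y + t * (\<phi> ?y \<bullet> x) \<le> \<Phi> x"
      using grad_y[of x] x by (simp add: algebra_simps)
    ultimately show "\<Phi> ?y \<le> \<Phi> x - t * C" by simp
  qed
qed

section \<open>The minimisation problem\<close>

lemma F_fun_along_line:
  assumes "\<And>n. n \<in> {1..T} \<Longrightarrow> GDERIV (F n) (u n) :> gF n (u n)"
  shows "((\<lambda>t. F_fun T F (\<lambda>n. u n + t *\<^sub>R h n)) has_real_derivative F_deriv T gF u h) (at 0)"
  unfolding F_fun_def F_deriv_def
  by (intro DERIV_minus DERIV_sum GDERIV_along_line assms)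

text \<open>The data of the problem. The function \<open>\<psi>\<close> is the inverse of \<open>\<phi>\<close>; of the subgradient
  condition on \<open>j\<close> at the origin its consequence \<open>j \<ge> 0\<close> is kept.\<close>
locale phi_laplacian_problem =
  fixes T :: nat and a :: real
    and \<phi> \<psi> :: "real^'n \<Rightarrow> real^'n" and \<Phi> :: "real^'n \<Rightarrow> real"
    and F :: "nat \<Rightarrow> real^'n \<Rightarrow> real" and gF :: "nat \<Rightarrow> real^'n \<Rightarrow> real^'n"
    and j :: "(real^'n) \<times> (real^'n) \<Rightarrow> ereal"
  assumes T: "1 \<le> T" and a: "0 < a"
    and phi_homeo: "homeomorphism (ball 0 a) UNIV \<phi> \<psi>"
    and Phi_grad: "\<And>x. x \<in> ball 0 a \<Longrightarrow> GDERIV \<Phi> x :> \<phi> x"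
    and Phi_cont: "continuous_on (cball 0 a) \<Phi>"
    and Phi_convex: "convex_on (cball 0 a) \<Phi>"
    and Phi_0: "\<Phi> 0 = 0"
    and F_grad: "\<And>n x. n \<in> {1..T} \<Longrightarrow> GDERIV (F n) x :> gF n x"
    and j_convex: "convex_fun j" and j_lsc: "lsc_fun j"
    and j_nonneg: "\<And>z. 0 \<le> j z" and j_0: "j 0 = 0"
    and lambda1_pos: "0 < lambda1 T a j"
begin

text \<open>The energy without the term \<open>j\<close>; it is meaningful where all differences are bounded by \<open>a\<close>,
  and \<open>j\<close> is the only summand of the energy there that can be infinite.\<close>
definition smooth_part :: "(nat \<Rightarrow> real^'n) \<Rightarrow> real" where
  "smooth_part u = (\<Sum>n\<le>T. \<Phi> (fdiff u n)) + F_fun T F u"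

lemma energy_eq:
  assumes "fdiff_sup T u \<le> a"
  shows "energy T a \<Phi> j F u = j (u 0, u (T + 1)) + ereal (smooth_part u)"
proof -
  have "Psi T a \<Phi> u = ereal (\<Sum>n\<le>T. \<Phi> (fdiff u n))"
    using assms sum_shift_pred[of "\<lambda>n. \<Phi> (fdiff u n)" T] by (simp add: Psi_def)
  then show ?thesis using j_nonneg[of "(u 0, u (T + 1))"]
    by (cases "j (u 0, u (T + 1))") (auto simp: energy_def Psi_J_def J_fun_def smooth_part_def)
qed

lemma energy_eq_PInf:
  assumes "\<not> (fdiff_sup T u \<le> a \<and> j (u 0, u (T + 1)) < \<infinity>)"
  shows "energy T a \<Phi> j F u = \<infinity>"
proof (cases "fdiff_sup T u \<le> a")
  case True
  with assms show ?thesis by (simp add: energy_eq)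
next
  case False
  then show ?thesis using j_nonneg[of "(u 0, u (T + 1))"]
    by (simp add: energy_def Psi_J_def J_fun_def Psi_def)
qed

text \<open>The energy depends on the values on \<open>{0..T+1}\<close> only. Minimality among the elements of
  \<open>seq_space T\<close> is therefore minimality among all functions, and competitors need not be
  restricted.\<close>
lemma energy_restrict: "energy T a \<Phi> j F (restrict v {0..T+1}) = energy T a \<Phi> j F v"
proof -
  let ?v = "restrict v {0..T+1}"
  have d: "fdiff ?v n = fdiff v n" if "n \<le> T" for n using that by (simp add: fdiff_def)
  then have "fdiff_sup T ?v \<le> a \<longleftrightarrow> fdiff_sup T v \<le> a" by (simp add: fdiff_sup_le_iff)
  moreover have "smooth_part ?v = smooth_part v"
    using d by (simp add: smooth_part_def F_fun_def)
  ultimately show ?thesis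
    using energy_eq[of v] energy_eq[of ?v] energy_eq_PInf[of v] energy_eq_PInf[of ?v]
    by (cases "fdiff_sup T v \<le> a") simp_all
qed

text \<open>The bound on the values of a sequence in the domain of \<open>\<Psi> + J\<close>.\<close>
definition seq_bound :: real where
  "seq_bound = a * (sqrt ((real T + 1) / (real T * lambda1 T a j)) + real T)"

lemma dom_norm_bound:
  assumes "w \<in> eff_dom T (Psi_J T a \<Phi> j)" "m \<le> T + 1"
  shows "norm (w m) \<le> seq_bound"
  using norm_le_of_lambda1_pos[OF a T j_convex j_lsc j_nonneg j_0 lambda1_pos] assms
  by (simp add: seq_bound_def eff_dom_Psi_J)

text \<open>A compact set that contains the domain of \<open>\<Psi> + J\<close>.\<close>
definition seq_ball :: "(nat \<Rightarrow> real^'n) set" where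
  "seq_ball = {w \<in> seq_space T. (\<forall>n\<le>T+1. norm (w n) \<le> seq_bound) \<and> (\<forall>n\<le>T. norm (fdiff w n) \<le> a)}"

lemma dom_subset_seq_ball: "eff_dom T (Psi_J T a \<Phi> j) \<subseteq> seq_ball"
  using dom_norm_bound by (auto simp: seq_ball_def eff_dom_Psi_J fdiff_sup_le_iff)

lemma compact_seq_ball: "compact seq_ball"
  unfolding seq_ball_def by (rule compact_bounded_seqs)

lemma palais_smale_condition: "PS_condition T a \<Phi> j F gF"
  unfolding PS_condition_def
proof (intro allI impI)
  fix w assume "PS_sequence T a \<Phi> j F gF w"
  then have "\<forall>k. w k \<in> seq_ball"
    using dom_subset_seq_ball by (auto simp: PS_sequence_def)
  then obtain u r where u: "u \<in> seq_ball" and r: "strict_mono r" "(w \<circ> r) \<longlonglongrightarrow> u"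
    using compact_seq_ball unfolding compact_eq_seq_compact_metric seq_compact_def by metis
  have "(\<lambda>k. w (r k) n) \<longlonglongrightarrow> u n" for n
    using continuous_on_tendsto_compose[OF continuous_on_product_coordinates[of n] r(2)] by (simp add: o_def)
  then have "(\<lambda>k. seq_norm T (\<lambda>n. w (r k) n - u n)) \<longlonglongrightarrow> sqrt (\<Sum>n=0..T+1. (norm (u n - u n))\<^sup>2)"
    unfolding seq_norm_def by (intro tendsto_intros)
  then show "\<exists>r. strict_mono r \<and> (\<exists>u\<in>seq_space T. (\<lambda>k. seq_norm T (\<lambda>n. w (r k) n - u n)) \<longlonglongrightarrow> 0)"
    using r(1) u by (auto simp: seq_ball_def)
qed

lemma zero_energy: "energy T a \<Phi> j F (\<lambda>_. 0) < \<infinity>"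
proof -
  have "fdiff_sup T (\<lambda>_. 0 :: real^'n) \<le> a" using a by (simp add: fdiff_sup_le_iff fdiff_def)
  from energy_eq[OF this] show ?thesis using j_0 by (simp add: zero_prod_def)
qed

lemma energy_attains_inf:
  obtains u where "u \<in> eff_dom T (Psi_J T a \<Phi> j)"
    "\<And>v. energy T a \<Phi> j F u \<le> energy T a \<Phi> j F v"
proof -
  have F_cont: "continuous_on UNIV (F n)" if "n \<in> {1..T}" for n
    using F_grad[OF that] unfolding gderiv_def
    by (auto intro!: continuous_at_imp_continuous_on has_derivative_continuous)
  have coord: "continuous_on seq_ball (\<lambda>w. w n)" for n
    using continuous_on_product_coordinates by (rule continuous_on_subset) simp
  have "continuous_on seq_ball smooth_part"
    unfolding smooth_part_def F_fun_def
  proof (intro continuous_intros)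
    fix n assume "n \<in> {..T}"
    then show "continuous_on seq_ball (\<lambda>w. \<Phi> (fdiff w n))"
      unfolding fdiff_def
      by (intro continuous_on_compose2[OF Phi_cont] continuous_on_diff coord)
        (auto simp: seq_ball_def fdiff_def)
  next
    fix n assume "n \<in> {1..T}"
    then show "continuous_on seq_ball (\<lambda>w. F n (w n))"
      by (intro continuous_on_compose2[OF F_cont] coord) auto
  qed
  moreover have "restrict (\<lambda>_. 0) {0..T+1} \<in> seq_ball"
    using a lambda1_pos by (auto simp: seq_ball_def seq_space_def seq_bound_def fdiff_def)
  moreover have "continuous_on seq_ball (\<lambda>w. (w 0, w (T + 1)))"
    by (intro continuous_on_Pair coord)
  ultimately obtain u where u: "u \<in> seq_ball"
    "\<And>v. v \<in> seq_ball \<Longrightarrow> j (u 0, u (T + 1)) + ereal (smooth_part u)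
        \<le> j (v 0, v (T + 1)) + ereal (smooth_part v)"
    using lsc_plus_continuous_attains_inf[OF j_lsc compact_seq_ball, of "\<lambda>w. (w 0, w (T + 1))" smooth_part]
    by auto
  have energy_ball: "energy T a \<Phi> j F v = j (v 0, v (T + 1)) + ereal (smooth_part v)"
    if "v \<in> seq_ball" for v
    using that by (intro energy_eq) (simp add: seq_ball_def fdiff_sup_le_iff)
  have min: "energy T a \<Phi> j F u \<le> energy T a \<Phi> j F v" for v
  proof -
    let ?v = "restrict v {0..T+1}"
    have "energy T a \<Phi> j F u \<le> energy T a \<Phi> j F ?v"
    proof (cases "?v \<in> seq_ball")
      case True
      then show ?thesis using u(2)[OF True] by (simp only: energy_ball u(1))
    next
      case False
      then have "?v \<notin> eff_dom T (Psi_J T a \<Phi> j)" using dom_subset_seq_ball by blast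
      then have "energy T a \<Phi> j F ?v = \<infinity>"
        by (intro energy_eq_PInf) (auto simp: eff_dom_Psi_J seq_space_def)
      then show ?thesis by simp
    qed
    then show ?thesis by (simp only: energy_restrict)
  qed
  have "energy T a \<Phi> j F u < \<infinity>" using min zero_energy by (rule le_less_trans)
  then have "fdiff_sup T u \<le> a \<and> j (u 0, u (T + 1)) < \<infinity>"
    using energy_eq_PInf[of u] by fastforce
  then have "u \<in> eff_dom T (Psi_J T a \<Phi> j)"
    using u(1) by (simp add: eff_dom_Psi_J seq_ball_def)
  then show thesis using min by (rule that)
qed

section \<open>The minimiser solves the problem\<close>

text \<open>The competitor \<open>v t\<close> is the shrunk sequence \<open>(1 - t) u\<close>; shrinking cannot increase \<open>j\<close>,
  which is convex and minimal at the origin.\<close>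
lemma minimizer_fdiff_less:
  assumes sup: "fdiff_sup T u \<le> a" and fin: "j (u 0, u (T + 1)) < \<infinity>"
    and min: "\<And>v. energy T a \<Phi> j F u \<le> energy T a \<Phi> j F v"
  shows "fdiff_sup T u < a"
proof (rule ccontr)
  assume "\<not> ?thesis"
  then obtain m where m: "m \<le> T" "\<not> norm (fdiff u m) < a"
    by (auto simp: fdiff_sup_less_iff)
  with sup have m_eq: "norm (fdiff u m) = a" by (simp add: fdiff_sup_le_iff order.antisym)
  obtain b where b: "j (u 0, u (T + 1)) = ereal b" "0 \<le> b"
    using fin j_nonneg[of "(u 0, u (T + 1))"] by (cases "j (u 0, u (T + 1))") auto
  define l where "l = F_deriv T gF u (\<lambda>n. - u n)"
  define M where "M = (\<Sum>n\<le>T. \<bar>\<Phi> (fdiff u n)\<bar>)"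
  define v where "v t = (\<lambda>n. u n + t *\<^sub>R (- u n))" for t
  have fdiff_v: "fdiff (v t) n = (1 - t) *\<^sub>R fdiff u n" for t n
    by (simp add: v_def fdiff_def algebra_simps)
  \<comment> \<open>The other differences add at most \<open>t M\<close>, and the potential term adds less than \<open>t (l + 1)\<close> for
    small \<open>t\<close>; so a decrease of \<open>t (M + l + 1)\<close> at \<open>m\<close> suffices.\<close>
  obtain d1 where d1: "0 < d1"
    "\<And>t. 0 < t \<Longrightarrow> t < d1 \<Longrightarrow> \<Phi> ((1 - t) *\<^sub>R fdiff u m) \<le> \<Phi> (fdiff u m) - t * (M + l + 1)"
    using radial_derivative_blowup[OF a phi_homeo Phi_grad Phi_cont Phi_convex m_eq, of "M + l + 1"]
    by metis
  have "((\<lambda>t. F_fun T F (v t) - t * (l + 1)) has_real_derivative l - 1 * (l + 1)) (at 0)"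
    unfolding v_def l_def
    by (intro DERIV_diff F_fun_along_line F_grad DERIV_cmult_right DERIV_ident)
  then obtain d2 where d2: "0 < d2"
    "\<And>t. 0 < t \<Longrightarrow> t < d2 \<Longrightarrow> F_fun T F (v t) - t * (l + 1) < F_fun T F u"
    using has_real_derivative_neg_dec_right[of _ "l - 1 * (l + 1)" 0 UNIV] by (force simp: v_def)
  define t where "t = min (1 / 2) (min d1 d2 / 2)"
  have t: "0 < t" "t < 1" "t < d1" "t < d2" using d1(1) d2(1) by (auto simp: t_def)
  have ball: "fdiff u n \<in> cball 0 a" if "n \<le> T" for n
    using sup that by (simp add: fdiff_sup_le_iff)
  have "\<Phi> (fdiff (v t) n) \<le> \<Phi> (fdiff u n) + t * \<bar>\<Phi> (fdiff u n)\<bar>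
      - (if n = m then t * (M + l + 1) else 0)" if "n \<le> T" for n
  proof (cases "n = m")
    case True
    then show ?thesis using d1(2)[OF t(1,3)] mult_nonneg_nonneg[OF less_imp_le[OF t(1)] abs_ge_zero]
      unfolding fdiff_v by (smt (verit, best))
  next
    case False
    have "\<Phi> ((1 - t) *\<^sub>R fdiff u n + t *\<^sub>R 0) \<le> (1 - t) * \<Phi> (fdiff u n) + t * \<Phi> 0"
      using convex_onD[OF Phi_convex, of t "fdiff u n" 0] t ball[OF that] a by simp
    also have "\<dots> \<le> \<Phi> (fdiff u n) + t * \<bar>\<Phi> (fdiff u n)\<bar>"
      using mult_left_mono[OF abs_ge_minus_self[of "\<Phi> (fdiff u n)"], of t] t Phi_0
      by (simp add: algebra_simps)
    finally show ?thesis using False by (simp add: fdiff_v)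
  qed
  then have "(\<Sum>n\<le>T. \<Phi> (fdiff (v t) n)) \<le> (\<Sum>n\<le>T. \<Phi> (fdiff u n) + t * \<bar>\<Phi> (fdiff u n)\<bar>
      - (if n = m then t * (M + l + 1) else 0))"
    by (intro sum_mono) auto
  also have "\<dots> = (\<Sum>n\<le>T. \<Phi> (fdiff u n)) + t * M - t * (M + l + 1)"
    using m(1) by (simp add: sum.distrib sum_subtractf M_def sum_distrib_left sum.delta)
  finally have less: "smooth_part (v t) < smooth_part u"
    using d2(2)[OF t(1,4)] by (simp add: smooth_part_def algebra_simps)
  have "norm (fdiff (v t) n) \<le> a" if "n \<le> T" for n
  proof -
    have "norm (fdiff (v t) n) \<le> 1 * norm (fdiff u n)"
      unfolding fdiff_v norm_scaleR using t by (intro mult_right_mono) auto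
    then show ?thesis using ball[OF that] by simp
  qed
  then have sup_v: "fdiff_sup T (v t) \<le> a" by (simp add: fdiff_sup_le_iff)
  have "j ((1 - t) *\<^sub>R (u 0, u (T + 1)) + t *\<^sub>R 0) \<le> ereal (1 - t) * j (u 0, u (T + 1)) + ereal t * j 0"
    using j_convex t unfolding convex_fun_def by blast
  also have "\<dots> \<le> ereal b" using b t j_0 by (simp add: mult_left_le_one_le)
  finally have "j (v t 0, v t (T + 1)) \<le> ereal b" by (simp add: v_def algebra_simps)
  then have "energy T a \<Phi> j F (v t) \<le> ereal b + ereal (smooth_part (v t))"
    unfolding energy_eq[OF sup_v] by (rule add_right_mono)
  also have "\<dots> < energy T a \<Phi> j F u" using less b by (simp add: energy_eq[OF sup])
  finally show False using min[of "v t"] by simp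
qed

text \<open>The term \<open>c\<close> is an upper bound for the slope of \<open>j\<close> in the direction of the endpoints of \<open>h\<close>,
  as \<open>j\<close> itself need not be differentiable.\<close>
lemma minimizer_first_variation:
  assumes sup: "fdiff_sup T u < a" and b: "j (u 0, u (T + 1)) = ereal b"
    and min: "\<And>v. energy T a \<Phi> j F u \<le> energy T a \<Phi> j F v"
    and c: "\<And>t. 0 < t \<Longrightarrow> t < 1 \<Longrightarrow>
      j (u 0 + t *\<^sub>R h 0, u (T + 1) + t *\<^sub>R h (T + 1)) \<le> ereal (b + t * c)"
  shows "0 \<le> (\<Sum>n\<le>T. \<phi> (fdiff u n) \<bullet> fdiff h n) + F_deriv T gF u h + c"
proof (rule ccontr)
  assume neg: "\<not> ?thesis"
  define v where "v t = (\<lambda>n. u n + t *\<^sub>R h n)" for t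
  have fdiff_v: "fdiff (v t) n = fdiff u n + t *\<^sub>R fdiff h n" for t n
    by (simp add: v_def fdiff_def algebra_simps)
  have v0: "v 0 = u" by (simp add: v_def)
  have "((\<lambda>t. (\<Sum>n\<le>T. \<Phi> (fdiff u n + t *\<^sub>R fdiff h n)) + F_fun T F (\<lambda>n. u n + t *\<^sub>R h n) + t * c)
      has_real_derivative (\<Sum>n\<le>T. \<phi> (fdiff u n) \<bullet> fdiff h n) + F_deriv T gF u h + 1 * c) (at 0)"
    using sup
    by (intro DERIV_add DERIV_sum GDERIV_along_line F_fun_along_line F_grad Phi_grad
        DERIV_cmult_right DERIV_ident) (auto simp: fdiff_sup_less_iff)
  then have "((\<lambda>t. smooth_part (v t) + t * c) has_real_derivative
      (\<Sum>n\<le>T. \<phi> (fdiff u n) \<bullet> fdiff h n) + F_deriv T gF u h + c) (at 0)"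
    by (simp add: smooth_part_def fdiff_v[unfolded v_def] v_def)
  then obtain d where d: "0 < d" "\<And>t. 0 < t \<Longrightarrow> t < d \<Longrightarrow> smooth_part (v t) + t * c < smooth_part u"
    using has_real_derivative_neg_dec_right[of _ _ 0 UNIV] neg by (force simp: v0 not_le)
  have "eventually (\<lambda>t. norm (fdiff (v t) n) < a) (at_right 0)" if "n \<le> T" for n
  proof (rule order_tendstoD)
    show "((\<lambda>t. norm (fdiff (v t) n)) \<longlongrightarrow> norm (fdiff u n + 0 *\<^sub>R fdiff h n)) (at_right 0)"
      unfolding fdiff_v by (intro tendsto_intros)
    show "norm (fdiff u n + 0 *\<^sub>R fdiff h n) < a" using sup that by (simp add: fdiff_sup_less_iff)
  qed
  then have "eventually (\<lambda>t. \<forall>n\<in>{..T}. norm (fdiff (v t) n) < a) (at_right 0)"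
    by (intro eventually_ball_finite) auto
  moreover have "eventually (\<lambda>t::real. 0 < t \<and> t < d \<and> t < 1) (at_right 0)"
    using d(1) unfolding eventually_at_right_field by (intro exI[of _ "min d 1"]) auto
  ultimately have "eventually (\<lambda>t. (\<forall>n\<in>{..T}. norm (fdiff (v t) n) < a) \<and> 0 < t \<and> t < d \<and> t < 1) (at_right 0)"
    by (rule eventually_conj)
  then obtain t where t: "\<forall>n\<in>{..T}. norm (fdiff (v t) n) < a" "0 < t" "t < d" "t < 1"
    using eventually_happens' trivial_limit_at_right_real by blast
  have sup_v: "fdiff_sup T (v t) \<le> a" using t(1) by (auto simp: fdiff_sup_le_iff less_imp_le)
  have "energy T a \<Phi> j F (v t) \<le> ereal (b + t * c) + ereal (smooth_part (v t))"
    unfolding energy_eq[OF sup_v] using c[OF t(2,4)] by (intro add_right_mono) (simp add: v_def)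
  also have "\<dots> < energy T a \<Phi> j F u"
    using d(2)[OF t(2,3)] b sup by (simp add: energy_eq)
  finally show False using min[of "v t"] by simp
qed

lemma minimizer_is_solution:
  assumes u: "u \<in> eff_dom T (Psi_J T a \<Phi> j)"
    and min: "\<And>v. energy T a \<Phi> j F u \<le> energy T a \<Phi> j F v"
  shows "is_solution T a \<phi> j gF u"
proof -
  let ?z = "(u 0, u (T + 1))"
  have u': "u \<in> seq_space T" "fdiff_sup T u \<le> a" "j ?z < \<infinity>"
    using u by (auto simp: eff_dom_Psi_J)
  have sup: "fdiff_sup T u < a" by (rule minimizer_fdiff_less[OF u'(2,3) min])
  obtain b where b: "j ?z = ereal b" using u'(3) j_nonneg[of ?z] by (cases "j ?z") auto
  have "- fdiff (\<lambda>k. \<phi> (fdiff u k)) (n - 1) = gF n (u n)" if n: "n \<in> {1..T}" for n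
  proof -
    \<comment> \<open>Varying \<open>u n\<close> in the direction \<open>- g\<close>, where \<open>g\<close> is the residual of the equation, gives
      \<open>0 \<le> - (g \<bullet> g)\<close>.\<close>
    define g where "g = \<phi> (fdiff u (n - 1)) - \<phi> (fdiff u n) - gF n (u n)"
    define h where "h k = (if k = n then - g else 0)" for k
    have "0 \<le> (\<Sum>k\<le>T. \<phi> (fdiff u k) \<bullet> fdiff h k) + F_deriv T gF u h + 0"
      using n b by (intro minimizer_first_variation[OF sup b min]) (simp add: h_def)
    also have "(\<Sum>k\<le>T. \<phi> (fdiff u k) \<bullet> fdiff h k) =
        (\<Sum>k\<le>T. (if k = n - 1 then - (\<phi> (fdiff u k) \<bullet> g) else 0) + (if k = n then \<phi> (fdiff u k) \<bullet> g else 0))"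
      using n by (intro sum.cong) (auto simp: h_def fdiff_def)
    also have "\<dots> = - (\<phi> (fdiff u (n - 1)) \<bullet> g) + \<phi> (fdiff u n) \<bullet> g"
    proof -
      have "n - 1 \<le> T" "n \<le> T" using n by auto
      then show ?thesis by (simp add: sum.distrib sum.delta)
    qed
    also have "F_deriv T gF u h = gF n (u n) \<bullet> g"
      using n unfolding F_deriv_def h_def by (simp add: if_distrib[of "inner _"] sum.delta cong: if_cong)
    finally have "g \<bullet> g \<le> 0" by (simp add: g_def inner_diff_left)
    then have "g = 0" by (metis inner_ge_zero inner_eq_zero_iff order_antisym)
    then show ?thesis using n by (simp add: g_def fdiff_def[of "\<lambda>k. \<phi> (fdiff u k)"] algebra_simps)
  qed
  moreover have "(\<phi> (fdiff u 0), - \<phi> (fdiff u T)) \<in> subdifferential j ?z"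
    unfolding subdifferential_def
  proof (intro CollectI allI)
    fix y
    show "j ?z + ereal ((\<phi> (fdiff u 0), - \<phi> (fdiff u T)) \<bullet> (y - ?z)) \<le> j y"
    proof (cases "j y")
      case (real r)
      \<comment> \<open>The endpoints move along the segment to \<open>y\<close>; on it, the slope of \<open>j\<close> is at most
        \<open>r - b\<close> by convexity.\<close>
      define h where "h k = (if k = 0 then fst y - u 0 else if k = T + 1 then snd y - u (T + 1) else 0)" for k
      have "0 \<le> (\<Sum>k\<le>T. \<phi> (fdiff u k) \<bullet> fdiff h k) + F_deriv T gF u h + (r - b)"
      proof (rule minimizer_first_variation[OF sup b min])
        fix t :: real assume t: "0 < t" "t < 1"
        have "j ((1 - t) *\<^sub>R ?z + t *\<^sub>R y) \<le> ereal (1 - t) * j ?z + ereal t * j y"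
          using j_convex t unfolding convex_fun_def by blast
        moreover have "(1 - t) *\<^sub>R ?z + t *\<^sub>R y = (u 0 + t *\<^sub>R h 0, u (T + 1) + t *\<^sub>R h (T + 1))"
          by (cases y) (simp add: h_def algebra_simps)
        ultimately show "j (u 0 + t *\<^sub>R h 0, u (T + 1) + t *\<^sub>R h (T + 1)) \<le> ereal (b + t * (r - b))"
          using b real by (simp add: algebra_simps)
      qed
      also have "(\<Sum>k\<le>T. \<phi> (fdiff u k) \<bullet> fdiff h k) =
        (\<Sum>k\<le>T. (if k = T then \<phi> (fdiff u k) \<bullet> (snd y - u (T + 1)) else 0)
           + (if k = 0 then - (\<phi> (fdiff u k) \<bullet> (fst y - u 0)) else 0))"
        using T by (intro sum.cong) (auto simp: h_def fdiff_def inner_diff_right)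
      also have "\<dots> = \<phi> (fdiff u T) \<bullet> (snd y - u (T + 1)) - \<phi> (fdiff u 0) \<bullet> (fst y - u 0)"
        by (simp add: sum.distrib sum.delta)
      also have "F_deriv T gF u h = 0" by (simp add: F_deriv_def h_def)
      finally show ?thesis using b real by (cases y) simp
    qed (use j_nonneg[of y] in auto)
  qed
  ultimately show ?thesis using u'(1) sup by (auto simp: is_solution_def subdiff_dom_def)
qed

end

theorem theorem5p1:
  fixes T :: nat and a :: real
    and \<phi> :: "real^'n \<Rightarrow> real^'n" and \<Phi> :: "real^'n \<Rightarrow> real"
    and F :: "nat \<Rightarrow> real^'n \<Rightarrow> real" and gF :: "nat \<Rightarrow> real^'n \<Rightarrow> real^'n"
    and j :: "(real^'n) \<times> (real^'n) \<Rightarrow> ereal"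
  assumes T: "T \<ge> 2" and a: "a > 0"
    and phi_homeo: "\<exists>\<psi>. homeomorphism (ball 0 a) UNIV \<phi> \<psi>"
    and phi_0: "\<phi> 0 = 0"
    and Phi_grad: "\<And>x. x \<in> ball 0 a \<Longrightarrow> GDERIV \<Phi> x :> \<phi> x"
    and Phi_cont: "continuous_on (cball 0 a) \<Phi>"
    and Phi_convex: "strictly_convex_on (cball 0 a) \<Phi>"
    and Phi_0: "\<Phi> 0 = 0"
    and F_cont: "continuous_on ({1..T} \<times> UNIV) (\<lambda>(n, x). F n x)"
    and F_grad: "\<And>n x. n \<in> {1..T} \<Longrightarrow> GDERIV (F n) x :> gF n x"
    and gF_cont: "continuous_on ({1..T} \<times> UNIV) (\<lambda>(n, x). gF n x)"
    and F_0: "\<And>n. n \<in> {1..T} \<Longrightarrow> F n 0 = 0"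
    and j_proper: "proper_fun j" and j_convex: "convex_fun j" and j_lsc: "lsc_fun j"
    and j_0: "j (0, 0) = 0" and j_subdiff_0: "(0, 0) \<in> subdifferential j (0, 0)"
    and lambda1_pos: "lambda1 T a j > 0"
  shows "(\<forall>w \<in> eff_dom T (Psi_J T a \<Phi> j). \<forall>m \<in> {0..T+1}.
            norm (w m) \<le> a * (sqrt ((real T + 1) / (real T * lambda1 T a j)) + real T))
       \<and> (\<exists>M::real. \<forall>u \<in> seq_space T. ereal M \<le> energy T a \<Phi> j F u)
       \<and> PS_condition T a \<Phi> j F gF
       \<and> (\<exists>u \<in> eff_dom T (Psi_J T a \<Phi> j).
            energy T a \<Phi> j F u = (INF v \<in> seq_space T. energy T a \<Phi> j F v)
            \<and> is_solution T a \<phi> j gF u)"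
proof -
  obtain \<psi> where psi: "homeomorphism (ball 0 a) UNIV \<phi> \<psi>" using phi_homeo by blast
  have conv: "convex_on (cball 0 a) \<Phi>"
  proof (rule convex_onI)
    fix t :: real and x y :: "real^'n"
    assume "0 < t" "t < 1" "x \<in> cball 0 a" "y \<in> cball 0 a"
    then show "\<Phi> ((1 - t) *\<^sub>R x + t *\<^sub>R y) \<le> (1 - t) * \<Phi> x + t * \<Phi> y"
      using Phi_convex unfolding strictly_convex_on_def
      by (cases "x = y") (auto simp: less_imp_le scaleR_left_distrib[symmetric] distrib_right[symmetric])
  qed simp
  have nonneg: "0 \<le> j z" for z
    by (cases z) (use j_subdiff_0 j_0 in \<open>simp add: subdifferential_def zero_prod_def[symmetric]\<close>)
  interpret phi_laplacian_problem T a \<phi> \<psi> \<Phi> F gF j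
    using T a psi Phi_grad Phi_cont conv Phi_0 F_grad j_convex j_lsc nonneg j_0 lambda1_pos
    by unfold_locales (auto simp: zero_prod_def)
  obtain u where u: "u \<in> eff_dom T (Psi_J T a \<Phi> j)"
    "\<And>v. energy T a \<Phi> j F u \<le> energy T a \<Phi> j F v"
    using energy_attains_inf by blast
  obtain M where M: "energy T a \<Phi> j F u = ereal M"
  proof -
    have "fdiff_sup T u \<le> a" "j (u 0, u (T + 1)) < \<infinity>" using u(1) by (auto simp: eff_dom_Psi_J)
    with nonneg[of "(u 0, u (T + 1))"] that show ?thesis
      by (cases "j (u 0, u (T + 1))") (auto simp: energy_eq)
  qed
  have "energy T a \<Phi> j F u = (INF v \<in> seq_space T. energy T a \<Phi> j F v)"
    using u by (intro antisym INF_greatest INF_lower) (auto simp: eff_dom_def)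
  moreover have "is_solution T a \<phi> j gF u" using u by (rule minimizer_is_solution)
  moreover have "\<forall>v\<in>seq_space T. ereal M \<le> energy T a \<Phi> j F v" using u(2) M by simp
  ultimately show ?thesis
    using u(1) palais_smale_condition dom_norm_bound unfolding seq_bound_def by auto
qed

end
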